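(* Let $a,b$ be nonnegative integers, let $p>2$ be a prime, and let $k$ be an integer with $0\leq k\leq\frac{p-1}{2}$. Then $$T^{a,b}_{p-1-k}\equiv (b^2-4a^2)^{\frac{p-1}{2}-k}\,T^{a,b}_k\pmod p.$$ In particular, writing $T_n=T^{1,1}_n$, one has $T_{p-1-k}\equiv(-3)^{\frac{p-1}{2}-k}T_k\pmod p$.
   Context: For a Laurent polynomial $Q(x)$, $\mathrm{ct}[Q(x)]$ denotes its constant term (the coefficient of $x^0$). For nonnegative integers $a,b$ and $n\ge 0$, the generalized central trinomial coefficient is $T^{a,b}_n=\mathrm{ct}\left[(ax^{-1}+b+ax)^n\right]$; equivalently, it counts lattice paths from $(0,0)$ to $(n,0)$ with steps UP $=(1,1)$, LEVEL $=(1,0)$ and DOWN $=(1,-1)$, with $a$ colors for each UP step and for each DOWN step and $b$ colors for each LEVEL step. The convention $y^0=1$ for every integer $y$ (including $y=0$) is used. *)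

theory Defs
  imports
    "HOL-Computational_Algebra.Formal_Laurent_Series"
    "HOL-Number_Theory.Number_Theory"
begin

(* Laurent polynomials are regarded as (finitely supported) formal Laurent series. *)
definition ct :: "'a::zero fls \<Rightarrow> 'a" where
  "ct Q = fls_nth Q 0"

definition central_trinomial :: "nat \<Rightarrow> nat \<Rightarrow> nat \<Rightarrow> int" where
  "central_trinomial a b n =
     ct ((fls_const (int a) * fls_X_inv + fls_const (int b) + fls_const (int a) * fls_X) ^ n)"

end

theory Submission
  imports Defs
begin

text \<open>
  With \<open>D = b^2 - 4 a^2\<close>, the numbers \<open>T n\<close> satisfy the three-term recurrence
  \<open>(n + 2) T (n + 2) = (2 n + 3) b T (n + 1) - (n + 1) D T n\<close>. Modulo \<open>p = 2 m + 1\<close> the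
  substitution \<open>n \<mapsto> p - 1 - n\<close> turns it into the same recurrence for \<open>D ^ (m - n) * T n\<close>, run
  downwards from \<open>n = m\<close>. The two sequences agree at \<open>n = m\<close>, and at \<open>n = m - 1\<close> because the middle
  coefficient vanishes modulo \<open>p\<close> there. Only numbers less than \<open>p\<close> are ever cancelled, so \<open>D\<close>
  may be divisible by \<open>p\<close>.
\<close>

text \<open>All coefficients are tracked, because the Pascal-type recursion for the constant term
  involves its neighbours.\<close>

definition trinomial_coeff :: "nat \<Rightarrow> nat \<Rightarrow> nat \<Rightarrow> int \<Rightarrow> int" where
  "trinomial_coeff a b n i =
     fls_nth ((fls_const (int a) * fls_X_inv + fls_const (int b) + fls_const (int a) * fls_X) ^ n) i"

lemma central_trinomial_eq: "central_trinomial a b n = trinomial_coeff a b n 0"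
  by (simp add: central_trinomial_def ct_def trinomial_coeff_def)

lemma trinomial_coeff_0: "trinomial_coeff a b 0 i = (if i = 0 then 1 else 0)"
  by (simp add: trinomial_coeff_def)

lemma trinomial_coeff_Suc:
  "trinomial_coeff a b (Suc n) i =
     int a * trinomial_coeff a b n (i + 1) + int b * trinomial_coeff a b n i
     + int a * trinomial_coeff a b n (i - 1)"
proof -
  define P where "P = fls_const (int a) * fls_X_inv + fls_const (int b) + fls_const (int a) * fls_X"
  have "P ^ Suc n = fls_const (int a) * (fls_X_inv * P ^ n) + fls_const (int b) * P ^ n
      + fls_const (int a) * (fls_X * P ^ n)"
    unfolding power_Suc by (subst (1) P_def) (simp only: distrib_right mult.assoc)
  thus ?thesis
    by (simp add: trinomial_coeff_def fls_X_inv_times_conv_shift(1) fls_X_times_conv_shift(1)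
        flip: P_def del: power_Suc)
qed

text \<open>The base is invariant under exchanging \<open>x\<close> and \<open>1 / x\<close>; in the
  Pascal-type recursion this swaps the two outer terms.\<close>

lemma trinomial_coeff_uminus: "trinomial_coeff a b n (- i) = trinomial_coeff a b n i"
proof (induction n arbitrary: i)
  case (Suc n)
  have "trinomial_coeff a b n (- i + 1) = trinomial_coeff a b n (i - 1)"
    using Suc[of "i - 1"] by simp
  moreover have "trinomial_coeff a b n (- i - 1) = trinomial_coeff a b n (i + 1)"
    using Suc[of "i + 1"] by (simp only: minus_add_distrib diff_conv_add_uminus)
  ultimately show ?case
    by (simp add: trinomial_coeff_Suc[of a b n] Suc[of i])
qed (simp add: trinomial_coeff_0)

text \<open>Coefficient form of \<open>x d/dx P^(n+1) = (n+1) P^n (a x - a / x)\<close> for \<open>P = a / x + b + a x\<close>.\<close>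
lemma trinomial_coeff_deriv:
  "i * trinomial_coeff a b (Suc n) i =
     int (Suc n) * int a * (trinomial_coeff a b n (i - 1) - trinomial_coeff a b n (i + 1))"
proof (induction n arbitrary: i)
  case 0
  show ?case by (auto simp: trinomial_coeff_Suc trinomial_coeff_0 simp flip: eq_neg_iff_add_eq_0)
next
  case (Suc n)
  define c where "c = trinomial_coeff a b"
  \<comment> \<open>The factor \<open>i\<close> is split as \<open>(i + 1) - 1\<close> and
    \<open>(i - 1) + 1\<close> to match the induction hypothesis; the last summand collects the
    leftovers.\<close>
  have "i * c (Suc (Suc n)) i =
      int a * ((i + 1) * c (Suc n) (i + 1)) + int b * (i * c (Suc n) i)
      + int a * ((i - 1) * c (Suc n) (i - 1)) + int a * (c (Suc n) (i - 1) - c (Suc n) (i + 1))"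
    by (simp add: c_def trinomial_coeff_Suc[of a b "Suc n"] algebra_simps)
  also have "\<dots> = int (Suc (Suc n)) * int a * (c (Suc n) (i - 1) - c (Suc n) (i + 1))"
    unfolding c_def Suc.IH by (simp add: trinomial_coeff_Suc algebra_simps)
  finally show ?case by (simp add: c_def)
qed

lemma central_trinomial_recurrence:
  "int (n + 2) * central_trinomial a b (n + 2) =
     int (2 * n + 3) * int b * central_trinomial a b (n + 1)
     - int (n + 1) * ((int b)\<^sup>2 - 4 * (int a)\<^sup>2) * central_trinomial a b n"
proof -
  define c where "c = trinomial_coeff a b"
  have sym: "c m (- 1) = c m 1" for m
    unfolding c_def by (rule trinomial_coeff_uminus)
  have T: "c (Suc m) 0 = 2 * int a * c m 1 + int b * c m 0" for m
    using trinomial_coeff_Suc[of a b m 0] sym[of m] by (simp add: c_def)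
  have R: "c (Suc n) 1 = int a * c n 2 + int b * c n 1 + int a * c n 0"
    using trinomial_coeff_Suc[of a b n 1] by (simp add: c_def)
  have D: "c (Suc n) 1 = int (Suc n) * int a * (c n 0 - c n 2)"
    using trinomial_coeff_deriv[of 1 a b n] by (simp add: c_def)
  \<comment> \<open>Adding \<open>n + 1\<close> times \<open>R\<close> to \<open>D\<close>
    eliminates \<open>c n 2\<close>.\<close>
  have "int (n + 2) * c (Suc n) 1 = int (n + 1) * (2 * int a * c n 0 + int b * c n 1)"
  proof -
    have "int (n + 2) * c (Suc n) 1 = c (Suc n) 1 + int (n + 1) * c (Suc n) 1"
      by (simp add: algebra_simps)
    also have "\<dots> = int (Suc n) * int a * (c n 0 - c n 2)
        + int (n + 1) * (int a * c n 2 + int b * c n 1 + int a * c n 0)"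
      using D R by simp
    finally show ?thesis by (simp add: algebra_simps)
  qed
  \<comment> \<open>Expanding by \<open>T\<close> at \<open>n + 1\<close> and then at
    \<open>n\<close> produces a \<open>b^2\<close> term that cancels, so that only a multiple of the
    previous relation remains.\<close>
  moreover have "int (n + 2) * c (Suc (Suc n)) 0 - int (2 * n + 3) * int b * c (Suc n) 0
      + int (n + 1) * ((int b)\<^sup>2 - 4 * (int a)\<^sup>2) * c n 0
      = 2 * int a * (int (n + 2) * c (Suc n) 1 - int (n + 1) * (2 * int a * c n 0 + int b * c n 1))"
    unfolding T[of "Suc n"] T[of n] of_nat_add of_nat_mult of_nat_numeral of_nat_1
    by (simp add: algebra_simps power2_eq_square)
  ultimately have "int (n + 2) * c (Suc (Suc n)) 0 - int (2 * n + 3) * int b * c (Suc n) 0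
      + int (n + 1) * ((int b)\<^sup>2 - 4 * (int a)\<^sup>2) * c n 0 = 0"
    by (simp only: diff_self mult_zero_right)
  thus ?thesis
    unfolding central_trinomial_eq c_def by simp
qed

lemma central_trinomial_reflection:
  fixes a b p m k :: nat
  assumes "prime p" and p: "p = 2 * m + 1" and "k \<le> m"
  shows "[central_trinomial a b (p - 1 - k)
            = ((int b)\<^sup>2 - 4 * (int a)\<^sup>2) ^ (m - k) * central_trinomial a b k] (mod int p)"
proof -
  define T where "T = central_trinomial a b"
  define D where "D = (int b)\<^sup>2 - 4 * (int a)\<^sup>2"
  have rec: "int (n + 2) * T (n + 2) =
      int (2 * n + 3) * int b * T (n + 1) - int (n + 1) * D * T n" for n
    unfolding T_def D_def by (rule central_trinomial_recurrence)
  have cancel: "[x = y] (mod int p)"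
    if "[int n * x = int n * y] (mod int p)" "0 < n" "n < p" for n x y
  proof -
    have "coprime n p"
      using that assms(1) by (metis coprime_commute nat_dvd_not_less prime_imp_coprime)
    thus ?thesis using that(1) by (simp add: cong_mult_lcancel)
  qed
  \<comment> \<open>Here \<open>d\<close> is the distance from the centre: the indices
    \<open>m + d\<close> and \<open>m - d\<close> add up to \<open>p - 1\<close>.\<close>
  have "d \<le> m \<longrightarrow> [T (m + d) = D ^ d * T (m - d)] (mod int p)" for d
  proof (induction d rule: less_induct)
    case (less d)
    show ?case
    proof
      assume dm: "d \<le> m"
      consider "d = 0" | "d = 1" | e where "d = e + 2"
        by (metis One_nat_def add_2_eq_Suc' not0_implies_Suc)
      thus "[T (m + d) = D ^ d * T (m - d)] (mod int p)"
      proof cases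
        case 1
        thus ?thesis by simp
      next
        case 2
        then obtain n where m: "m = n + 1" using dm by (metis le_add_diff_inverse2)
        \<comment> \<open>The recurrence at \<open>n = m - 1\<close>, where
          \<open>2 * n + 3 = p\<close> and \<open>n + 2 = p - m\<close>.\<close>
        have "int m * T (m + 1) - int m * (D * T (m - 1))
            = int p * (T (m + 1) - int b * T m)"
          using rec[of n] by (simp add: p m algebra_simps)
        hence "[int m * T (m + 1) = int m * (D * T (m - 1))] (mod int p)"
          by (simp add: cong_iff_dvd_diff)
        from cancel[OF this] show ?thesis using 2 m p by simp
      next
        case (3 e)
        \<comment> \<open>This local \<open>k\<close> is \<open>m - d\<close>, the mirror image of
          \<open>m + d\<close>.\<close>
        then obtain k where m: "m = k + e + 2" using dm by (metis add.assoc le_add_diff_inverse2)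
        have IH1: "[T (m + e) = D ^ e * T (k + 2)] (mod int p)"
          using less[of e] 3 m by simp
        have IH2: "[T (m + e + 1) = D ^ (e + 1) * T (k + 1)] (mod int p)"
          using less[of "e + 1"] 3 m by simp
        \<comment> \<open>Modulo \<open>p\<close> the coefficients \<open>m + e + 2\<close>,
          \<open>2 * (m + e) + 3\<close> and \<open>m + e + 1\<close> are the negatives of
          \<open>k + 1\<close>, \<open>2 * k + 3\<close> and \<open>k + 2\<close>.\<close>
        have "int (k + 1) * T (m + e + 2)
              - (int (2 * k + 3) * int b * T (m + e + 1) - int (k + 2) * D * T (m + e))
            = int p * (T (m + e + 2) - 2 * int b * T (m + e + 1) + D * T (m + e))"
          using rec[of "m + e"] by (simp add: p m algebra_simps)
        hence "[int (k + 1) * T (m + e + 2) =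
            int (2 * k + 3) * int b * T (m + e + 1) - int (k + 2) * D * T (m + e)] (mod int p)"
          by (simp add: cong_iff_dvd_diff)
        also have "[int (2 * k + 3) * int b * T (m + e + 1) - int (k + 2) * D * T (m + e) =
            int (2 * k + 3) * int b * (D ^ (e + 1) * T (k + 1))
            - int (k + 2) * D * (D ^ e * T (k + 2))] (mod int p)"
          by (intro cong_diff cong_mult cong_refl IH1 IH2)
        also have "int (2 * k + 3) * int b * (D ^ (e + 1) * T (k + 1))
            - int (k + 2) * D * (D ^ e * T (k + 2))
            = D ^ (e + 1) * (int (2 * k + 3) * int b * T (k + 1) - int (k + 2) * T (k + 2))"
          by (simp add: algebra_simps)
        \<comment> \<open>The recurrence at \<open>k\<close>, solved for the lowest term, supplies
          the missing factor \<open>D\<close>.\<close>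
        also have "int (2 * k + 3) * int b * T (k + 1) - int (k + 2) * T (k + 2)
            = int (k + 1) * D * T k"
          using rec[of k] by simp
        also have "D ^ (e + 1) * (int (k + 1) * D * T k) = int (k + 1) * (D ^ (e + 2) * T k)"
          by (simp add: algebra_simps)
        finally have "[T (m + e + 2) = D ^ (e + 2) * T k] (mod int p)"
          by (rule cancel) (simp_all add: p m)
        thus ?thesis using 3 m by simp
      qed
    qed
  qed
  moreover have "m + (m - k) = p - 1 - k" "m - (m - k) = k"
    using assms by auto
  ultimately show ?thesis
    unfolding T_def D_def by (metis diff_le_self)
qed

theorem theorem4:
  fixes a b p k :: nat
  assumes "prime p" and "p > 2" and "k \<le> (p - 1) div 2"
  shows "[central_trinomial a b (p - 1 - k)
            = ((int b)\<^sup>2 - 4 * (int a)\<^sup>2) ^ ((p - 1) div 2 - k) * central_trinomial a b k] (mod int p)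
       \<and> [central_trinomial 1 1 (p - 1 - k)
            = (-3) ^ ((p - 1) div 2 - k) * central_trinomial 1 1 k] (mod int p)"
proof -
  have "p = 2 * ((p - 1) div 2) + 1"
    using prime_odd_nat[OF assms(1,2)] by (auto elim: oddE)
  note reflection = central_trinomial_reflection[OF assms(1) this assms(3)]
  show ?thesis
    using reflection[of a b] reflection[of 1 1] by simp
qed

end
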